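(* Let $0<p<1$ and $q=1-p$. For every integer $k\ge1$, every real $h$ and every $r\in\mathbb Z$, $$\widetilde A_k(h+r;p)=\widetilde A_k(h;p)-\frac{\Xi_k(p)}{k}\,S_k(h,r),\qquad \widehat A_k(h+r;p)=\widehat A_k(h;p)-\frac{\Xi_k(p)}{k}\,T_k(h,r).$$ Consequently $\widetilde A_k(h+r;p)$ and $\widehat A_k(h+r;p)$ are polynomials in $r$ of degree at most $k+1$, in which the coefficient of $r^{k+1}$ is $-\Xi_k(p)/\bigl(k(k+1)\bigr)$. The degree is exactly $k+1$ unless $\Xi_k(p)=0$, and $\Xi_k(p)=0$ occurs precisely when $k$ is even and $p=q=\tfrac12$.
   Context: $B_n(t)$ are the Bernoulli polynomials, $\sum_{n\ge0}B_n(t)z^n/n!=\frac{z}{e^z-1}e^{tz}$, $B_n=B_n(0)$ (so $B_1=-\tfrac12$), and $\widehat B_n(t)=\tfrac12\bigl[B_n(t)+B_n(t+1)\bigr]$. For $k\ge1$ define $$\Xi_k(p)=\frac{(-1)^{k+1}}{p^k}+\frac1{q^k},\quad \widetilde A_k(t;p)=\frac{(-1)^{k+1}B_{k+1}-\Xi_k(p)B_{k+1}(t)}{k(k+1)},\quad \widehat A_k(t;p)=\frac{(-1)^{k+1}B_{k+1}-\Xi_k(p)\widehat B_{k+1}(t)}{k(k+1)}.$$ The power sums are: for $r\ge1$, $$S_k(h,r)=\sum_{j=0}^{r-1}(h+j)^k,\qquad T_k(h,r)=\tfrac12h^k+\sum_{j=1}^{r-1}(h+j)^k+\tfrac12(h+r)^k;$$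 $S_k(h,0)=T_k(h,0)=0$; and for $r\le-1$, $$S_k(h,r)=-\sum_{j=1}^{-r}(h-j)^k,\qquad T_k(h,r)=-\Bigl[\tfrac12(h+r)^k+\sum_{j=1}^{-r-1}(h-j)^k+\tfrac12h^k\Bigr].$$ *)

theory Defs
  imports "HOL-Computational_Algebra.Computational_Algebra"
begin

(* B_n(t) is read off from the generating function z / (e^z - 1) * e^(t z), as formal power
   series in z.  The divisor has subdegree 1 and fps division cancels it against fps_X, so
   the quotient is the true one; this is bernpoly_divisor below. *)
definition bernpoly :: "nat \<Rightarrow> real \<Rightarrow> real" where
  "bernpoly n t = fact n * fps_nth (fps_X / (fps_exp 1 - 1) * fps_exp t) n"

abbreviation bernoulli :: "nat \<Rightarrow> real" where
  "bernoulli n \<equiv> bernpoly n 0"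

definition bernpoly_hat :: "nat \<Rightarrow> real \<Rightarrow> real" where
  "bernpoly_hat n t = (bernpoly n t + bernpoly n (t + 1)) / 2"

definition Xi :: "nat \<Rightarrow> real \<Rightarrow> real" where
  "Xi k p = (-1) ^ (k + 1) / p ^ k + 1 / (1 - p) ^ k"

definition A_tilde :: "nat \<Rightarrow> real \<Rightarrow> real \<Rightarrow> real" where
  "A_tilde k t p =
     ((-1) ^ (k + 1) * bernoulli (k + 1) - Xi k p * bernpoly (k + 1) t)
       / (real k * (real k + 1))"

definition A_hat :: "nat \<Rightarrow> real \<Rightarrow> real \<Rightarrow> real" where
  "A_hat k t p =
     ((-1) ^ (k + 1) * bernoulli (k + 1) - Xi k p * bernpoly_hat (k + 1) t)
       / (real k * (real k + 1))"

definition S_sum :: "nat \<Rightarrow> real \<Rightarrow> int \<Rightarrow> real" where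
  "S_sum k h r =
     (if r \<ge> 1 then \<Sum>j = 0..r - 1. (h + of_int j) ^ k
      else if r = 0 then 0
      else - (\<Sum>j = 1..- r. (h - of_int j) ^ k))"

definition T_sum :: "nat \<Rightarrow> real \<Rightarrow> int \<Rightarrow> real" where
  "T_sum k h r =
     (if r \<ge> 1 then
        h ^ k / 2 + (\<Sum>j = 1..r - 1. (h + of_int j) ^ k) + (h + of_int r) ^ k / 2
      else if r = 0 then 0
      else
        - ((h + of_int r) ^ k / 2 + (\<Sum>j = 1..- r - 1. (h - of_int j) ^ k) + h ^ k / 2))"

lemma bernpoly_divisor:
  "fps_X / (fps_exp 1 - 1) * (fps_exp 1 - 1) = (fps_X :: real fps)"
proof -
  have nz: "fps_exp 1 - 1 \<noteq> (0 :: real fps)"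
    by (metis eq_iff_diff_eq_0 fps_exp_eq_1_iff zero_neq_one)
  have "subdegree (fps_exp 1 - 1 :: real fps) \<le> 1"
    by (rule subdegree_leI) simp
  then have "(fps_exp 1 - 1 :: real fps) dvd fps_X"
    using nz by (simp add: fps_dvd_iff)
  then show ?thesis by simp
qed

lemma bernpoly_gf:
  "Abs_fps (\<lambda>n. bernpoly n t / fact n) = fps_X / (fps_exp 1 - 1) * fps_exp t"
  by (rule fps_ext) (simp add: bernpoly_def)

end

theory Submission
  imports Defs
begin

text \<open>
  Multiplying the generating function by $e^z - 1$ gives $B_n(t+1) - B_n(t) = n t^{n-1}$, so
  $\widetilde A_k(t+1) - \widetilde A_k(t) = -\Xi_k t^k / k$, which telescopes in both
  directions. The statements for $\widehat A_k$ and $T_k$ follow from those for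
  $\widetilde A_k$ and $S_k$, because hatted quantities are averages over $h$ and $h+1$.
  The polynomial claims come from the addition formula for $B_n(h+x)$ together with $B_0 = 1$.
\<close>

text \<open>Since $e^z - 1$ starts with $z$, the coefficient of $z$ in its product with the quotient
  is the constant term of the quotient.\<close>

lemma bernpoly_0 [simp]: "bernpoly 0 t = 1"
proof -
  have "fps_nth (fps_X / (fps_exp 1 - 1) * (fps_exp 1 - 1)) 1 = (1 :: real)"
    by (simp add: bernpoly_divisor)
  then show ?thesis
    by (simp add: bernpoly_def fps_mult_nth)
qed

lemma bernpoly_add_one: "bernpoly (Suc n) (t + 1) = bernpoly (Suc n) t + real (Suc n) * t ^ n"
proof -
  let ?G = "fps_X / (fps_exp 1 - 1) :: real fps"
  have "?G * fps_exp (t + 1) - ?G * fps_exp t = ?G * (fps_exp 1 - 1) * fps_exp t"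
    by (simp add: fps_exp_add_mult algebra_simps)
  also have "\<dots> = fps_X * fps_exp t"
    by (simp add: bernpoly_divisor)
  \<comment> \<open>The factor \<open>fps_X\<close> shifts coefficients by one, so index
    \<open>Suc n\<close> reads off coefficient \<open>n\<close> of $e^{tz}$.\<close>
  finally have "fps_nth (?G * fps_exp (t + 1) - ?G * fps_exp t) (Suc n) = t ^ n / fact n"
    by (simp add: fps_X_mult_nth)
  then have "fps_nth (?G * fps_exp (t + 1)) (Suc n) - fps_nth (?G * fps_exp t) (Suc n) = t ^ n / fact n"
    by (simp only: fps_sub_nth)
  then have "fact (Suc n) * (fps_nth (?G * fps_exp (t + 1)) (Suc n) - fps_nth (?G * fps_exp t) (Suc n))
      = fact (Suc n) * (t ^ n / fact n)"
    by (rule arg_cong)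
  moreover have "fact (Suc n) * (t ^ n / fact n) = real (Suc n) * t ^ n"
    by (simp add: field_simps del: of_nat_Suc)
  ultimately show ?thesis
    unfolding bernpoly_def by (simp only: right_diff_distrib)
qed

text \<open>Cauchy product of the generating function at \<open>h\<close> with $e^{xz}$; the
  factorials combine into binomial coefficients.\<close>

lemma bernpoly_add:
  "bernpoly n (h + x) = (\<Sum>i\<le>n. real (n choose i) * bernpoly i h * x ^ (n - i))"
proof -
  let ?G = "fps_X / (fps_exp 1 - 1) :: real fps"
  have "bernpoly n (h + x) = fact n * fps_nth ((?G * fps_exp h) * fps_exp x) n"
    by (simp add: bernpoly_def fps_exp_add_mult mult.assoc)
  also have "\<dots> = (\<Sum>i\<le>n. fact n * (fps_nth (?G * fps_exp h) i * (x ^ (n - i) / fact (n - i))))"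
    by (simp add: fps_mult_nth[of "?G * fps_exp h"] sum_distrib_left atLeast0AtMost)
  also have "\<dots> = (\<Sum>i\<le>n. real (n choose i) * bernpoly i h * x ^ (n - i))"
    by (rule sum.cong) (simp_all add: bernpoly_def binomial_fact)
  finally show ?thesis .
qed

lemma bernpoly_shift_poly:
  obtains P :: "real poly"
  where "\<And>x. poly P x = bernpoly n (h + x)" "degree P \<le> n" "coeff P n = 1"
proof
  let ?P = "\<Sum>i\<le>n. monom (real (n choose i) * bernpoly i h) (n - i)"
  show "poly ?P x = bernpoly n (h + x)" for x
    by (simp add: bernpoly_add poly_sum poly_monom)
  show "degree ?P \<le> n"
    by (intro degree_sum_le) (auto intro: order_trans[OF degree_monom_le])
  \<comment> \<open>Only \<open>i = 0\<close> reaches exponent \<open>n\<close>, and its coefficient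
    is $B_0(h) = 1$.\<close>
  have "coeff ?P n = (\<Sum>i\<le>n. if i = 0 then 1 else 0)"
    unfolding coeff_sum by (rule sum.cong) auto
  then show "coeff ?P n = 1"
    by simp
qed

lemma bernpoly_hat_shift_poly:
  obtains P :: "real poly"
  where "\<And>x. poly P x = bernpoly_hat n (h + x)" "degree P \<le> n" "coeff P n = 1"
proof -
  obtain P where P: "\<And>x. poly P x = bernpoly n (h + x)" "degree P \<le> n" "coeff P n = 1"
    using bernpoly_shift_poly by blast
  obtain Q where Q: "\<And>x. poly Q x = bernpoly n (h + 1 + x)" "degree Q \<le> n" "coeff Q n = 1"
    using bernpoly_shift_poly by blast
  show thesis
  proof
    show "poly (smult (1 / 2) (P + Q)) x = bernpoly_hat n (h + x)" for x
      by (simp add: P Q bernpoly_hat_def add_ac)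
    show "degree (smult (1 / 2) (P + Q)) \<le> n"
      using P Q by (simp add: degree_add_le)
    show "coeff (smult (1 / 2) (P + Q)) n = 1"
      by (simp add: P Q)
  qed
qed

text \<open>Degree count shared by the tilde and hat cases, both affine in a monic polynomial.
  Positivity of \<open>n\<close> keeps the constant \<open>a\<close> away from the top
  coefficient.\<close>

lemma affine_image_monic_poly:
  fixes P :: "'a :: field poly"
  assumes "\<And>x. poly P x = f x" "degree P \<le> n" "coeff P n = 1" "n > 0"
  obtains Q where "\<And>x. poly Q x = a + b * f x" "degree Q \<le> n" "coeff Q n = b"
    "degree Q = n \<longleftrightarrow> b \<noteq> 0"
proof
  let ?Q = "[:a:] + smult b P"
  show "poly ?Q x = a + b * f x" for x
    by (simp add: assms)
  show deg: "degree ?Q \<le> n"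
    using assms by (intro degree_add_le) auto
  show coeff: "coeff ?Q n = b"
    using assms by (cases n) auto
  show "degree ?Q = n \<longleftrightarrow> b \<noteq> 0"
  proof
    assume "degree ?Q = n"
    then show "b \<noteq> 0"
      using coeff \<open>n > 0\<close> by (metis degree_0 leading_coeff_0_iff less_irrefl)
  next
    assume "b \<noteq> 0"
    then show "degree ?Q = n"
      using deg coeff le_degree[of ?Q n] by auto
  qed
qed

lemma A_tilde_add_one:
  assumes "k \<ge> 1"
  shows "A_tilde k (t + 1) p = A_tilde k t p - Xi k p / real k * t ^ k"
proof -
  \<comment> \<open>The factor \<open>k + 1\<close> from the Bernoulli difference cancels the one in
    the denominator.\<close>
  have "Xi k p / real k * t ^ k
      = Xi k p * (real (Suc k) * t ^ k) / (real k * (real k + 1))"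
    using assms by (simp add: add.commute[of _ 1])
  then show ?thesis
    unfolding A_tilde_def Suc_eq_plus1[symmetric] bernpoly_add_one
    by (simp only: diff_divide_distrib add_divide_distrib distrib_left)
qed

text \<open>The expression is affine in the Bernoulli value, so averaging that value averages the
  whole.\<close>

lemma A_hat_eq_average: "A_hat k t p = (A_tilde k t p + A_tilde k (t + 1) p) / 2"
proof -
  let ?c = "(- 1) ^ (k + 1) * bernoulli (k + 1)" and ?b = "bernpoly (k + 1)"
  have "?c - Xi k p * bernpoly_hat (k + 1) t
      = ((?c - Xi k p * ?b t) + (?c - Xi k p * ?b (t + 1))) / 2"
    by (simp add: bernpoly_hat_def field_simps)
  then show ?thesis
    unfolding A_hat_def A_tilde_def by (simp only: add_divide_distrib divide_divide_eq_left mult.commute)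
qed

lemma S_sum_0 [simp]: "S_sum k h 0 = 0"
  by (simp add: S_sum_def)

text \<open>The sign and range for negative \<open>r\<close> make a single recurrence valid on all
  integers, including the passage from -1 to 0, where the remaining range is empty.\<close>

lemma S_sum_add_one: "S_sum k h (r + 1) = S_sum k h r + (h + of_int r) ^ k"
proof (cases "r \<ge> 0")
  case True
  then have "{0..r} = insert r {0..r - 1}"
    by auto
  then show ?thesis
    using True by (auto simp: S_sum_def)
next
  case False
  then have "{1..- r} = insert (- r) {1..- r - 1}"
    by auto
  then show ?thesis
    using False by (auto simp: S_sum_def)
qed

text \<open>Trapezoidal rule as the mean of the two endpoint rules: the ranges for \<open>h\<close>
  and \<open>h + 1\<close> share all interior nodes, and each end node occurs in only one of them,
  hence the weight 1/2.\<close>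

lemma T_sum_eq_average: "T_sum k h r = (S_sum k h r + S_sum k (h + 1) r) / 2"
proof -
  consider "r \<ge> 1" | "r = 0" | "r \<le> - 1"
    by linarith
  then show ?thesis
  proof cases
    case 1
    have "(\<Sum>j = 0..r - 1. (h + 1 + of_int j) ^ k) = (\<Sum>j = 1..r. (h + of_int j) ^ k)"
      by (rule sum.reindex_bij_witness[of _ "\<lambda>j. j - 1" "\<lambda>j. j + 1"]) (auto simp: add_ac)
    moreover have "{1..r} = insert r {1..r - 1}" "{0..r - 1} = insert 0 {1..r - 1}"
      using 1 by auto
    ultimately show ?thesis
      using 1 by (simp add: S_sum_def T_sum_def field_simps)
  next
    case 2
    then show ?thesis
      by (simp add: T_sum_def)
  next
    case 3
    have "(\<Sum>j = 1..- r. (h + 1 - of_int j) ^ k) = (\<Sum>j = 0..- r - 1. (h - of_int j) ^ k)"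
      by (rule sum.reindex_bij_witness[of _ "\<lambda>j. j + 1" "\<lambda>j. j - 1"]) (auto simp: algebra_simps)
    moreover have "{1..- r} = insert (- r) {1..- r - 1}" "{0..- r - 1} = insert 0 {1..- r - 1}"
      using 3 by auto
    ultimately show ?thesis
      using 3 by (simp add: S_sum_def T_sum_def field_simps)
  qed
qed

lemma A_tilde_add_of_int:
  assumes "k \<ge> 1"
  shows "A_tilde k (h + of_int r) p = A_tilde k h p - Xi k p / real k * S_sum k h r"
proof (induction r rule: int_induct[where k = 0])
  case base
  show ?case
    by simp
next
  case (step1 r)
  then show ?case
    using A_tilde_add_one[OF assms, of "h + of_int r" p]
    by (simp add: S_sum_add_one distrib_left add.assoc)
next
  \<comment> \<open>Going down, the one-step identity is taken at \<open>r - 1\<close> and solved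
    for the earlier value.\<close>
  case (step2 r)
  then show ?case
    using A_tilde_add_one[OF assms, of "h + of_int (r - 1)" p] S_sum_add_one[of k h "r - 1"]
    by (simp add: distrib_left add.assoc add_divide_distrib)
qed

lemma A_hat_add_of_int:
  assumes "k \<ge> 1"
  shows "A_hat k (h + of_int r) p = A_hat k h p - Xi k p / real k * T_sum k h r"
proof -
  \<comment> \<open>The unit shift moves into the base point, so the tilde identity applies at both
    \<open>h\<close> and \<open>h + 1\<close>.\<close>
  have "h + of_int r + 1 = h + 1 + of_int r"
    by simp
  then show ?thesis
    by (simp only: A_hat_eq_average T_sum_eq_average A_tilde_add_of_int[OF assms])
      (simp add: add_divide_distrib diff_divide_distrib distrib_left)
qed

lemma Xi_eq_0_iff:
  assumes "0 < p" "p < 1" "k \<ge> 1"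
  shows "Xi k p = 0 \<longleftrightarrow> even k \<and> p = 1 / 2"
proof (cases "even k")
  case True
  \<comment> \<open>For even \<open>k\<close> the two terms have opposite signs, and $x^k$ is
    injective on positive reals.\<close>
  then have "Xi k p = 0 \<longleftrightarrow> p ^ k = (1 - p) ^ k"
    using assms by (auto simp: Xi_def field_simps)
  also have "\<dots> \<longleftrightarrow> p = 1 - p"
    using assms by (intro power_eq_iff_eq_base) auto
  finally show ?thesis
    using True by auto
next
  case False
  \<comment> \<open>For odd \<open>k\<close> both terms are positive.\<close>
  then have "Xi k p > 0"
    using assms by (auto simp: Xi_def intro!: add_pos_pos)
  with False show ?thesis
    by simp
qed

theorem theorem4p2:
  fixes p q h :: real and k :: nat
  assumes "0 < p" and "p < 1" and "q = 1 - p" and "k \<ge> 1"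
  shows
    "(\<forall>r::int.
        A_tilde k (h + of_int r) p = A_tilde k h p - Xi k p / real k * S_sum k h r \<and>
        A_hat k (h + of_int r) p = A_hat k h p - Xi k p / real k * T_sum k h r) \<and>
     (\<exists>P :: real poly.
        (\<forall>r::int. A_tilde k (h + of_int r) p = poly P (of_int r)) \<and>
        degree P \<le> k + 1 \<and>
        coeff P (k + 1) = - Xi k p / (real k * (real k + 1)) \<and>
        (degree P = k + 1 \<longleftrightarrow> Xi k p \<noteq> 0)) \<and>
     (\<exists>P :: real poly.
        (\<forall>r::int. A_hat k (h + of_int r) p = poly P (of_int r)) \<and>
        degree P \<le> k + 1 \<and>
        coeff P (k + 1) = - Xi k p / (real k * (real k + 1)) \<and>
        (degree P = k + 1 \<longleftrightarrow> Xi k p \<noteq> 0)) \<and>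
     (Xi k p = 0 \<longleftrightarrow> even k \<and> p = 1 / 2 \<and> q = 1 / 2)"
proof (intro conjI allI)
  let ?n = "k + 1"
  let ?d = "real k * (real k + 1)"
  \<comment> \<open>Both functions equal \<open>?a\<close> plus \<open>?b\<close> times a monic
    polynomial of degree \<open>?n\<close> in the shift, so \<open>?b\<close> is the top
    coefficient.\<close>
  let ?a = "(- 1) ^ (k + 1) * bernoulli (k + 1) / ?d"
  let ?b = "- Xi k p / ?d"
  have b: "?b \<noteq> 0 \<longleftrightarrow> Xi k p \<noteq> 0"
    using \<open>k \<ge> 1\<close> by simp
  show "A_tilde k (h + of_int r) p = A_tilde k h p - Xi k p / real k * S_sum k h r" for r
    using \<open>k \<ge> 1\<close> by (rule A_tilde_add_of_int)
  show "A_hat k (h + of_int r) p = A_hat k h p - Xi k p / real k * T_sum k h r" for r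
    using \<open>k \<ge> 1\<close> by (rule A_hat_add_of_int)
  show "Xi k p = 0 \<longleftrightarrow> even k \<and> p = 1 / 2 \<and> q = 1 / 2"
    using Xi_eq_0_iff[of p k] assms by auto
  have tilde: "A_tilde k t p = ?a + ?b * bernpoly ?n t" for t
    by (simp add: A_tilde_def diff_divide_distrib)
  obtain P where P: "\<And>x. poly P x = bernpoly ?n (h + x)" "degree P \<le> ?n" "coeff P ?n = 1"
    using bernpoly_shift_poly by blast
  obtain Q where "\<And>x. poly Q x = ?a + ?b * bernpoly ?n (h + x)" "degree Q \<le> ?n"
      "coeff Q ?n = ?b" "degree Q = ?n \<longleftrightarrow> ?b \<noteq> 0"
    using affine_image_monic_poly[OF P, where a = ?a and b = ?b] by auto
  then show "\<exists>P :: real poly.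
      (\<forall>r::int. A_tilde k (h + of_int r) p = poly P (of_int r)) \<and>
      degree P \<le> ?n \<and> coeff P ?n = ?b \<and> (degree P = ?n \<longleftrightarrow> Xi k p \<noteq> 0)"
    unfolding b tilde by metis
  have hat: "A_hat k t p = ?a + ?b * bernpoly_hat ?n t" for t
    by (simp add: A_hat_def diff_divide_distrib)
  obtain P where P: "\<And>x. poly P x = bernpoly_hat ?n (h + x)" "degree P \<le> ?n" "coeff P ?n = 1"
    using bernpoly_hat_shift_poly by blast
  obtain Q where "\<And>x. poly Q x = ?a + ?b * bernpoly_hat ?n (h + x)" "degree Q \<le> ?n"
      "coeff Q ?n = ?b" "degree Q = ?n \<longleftrightarrow> ?b \<noteq> 0"
    using affine_image_monic_poly[OF P, where a = ?a and b = ?b] by auto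
  then show "\<exists>P :: real poly.
      (\<forall>r::int. A_hat k (h + of_int r) p = poly P (of_int r)) \<and>
      degree P \<le> ?n \<and> coeff P ?n = ?b \<and> (degree P = ?n \<longleftrightarrow> Xi k p \<noteq> 0)"
    unfolding b hat by metis
qed

end
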